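(* Let $\mathcal{G}^*$ be the AMP essential graph of an AMP Markov equivalence class $\mathcal{G}$ of chain graphs. Each arrow in $\mathcal{G}^*$ is well protected in $\mathcal{G}^*$.
   Context: All graphs are finite; between two distinct vertices there is at most one edge, which is either a line $a-b$ or an arrow $a\to b$. $a\Rightarrow b$ means $a\to b$ or $a-b$. A $k$-cycle ($k\ge 3$) is a sequence $(v_0,\dots,v_k=v_0)$, with $v_0,\dots,v_{k-1}$ distinct, such that $v_{i-1}\Rightarrow v_i$ for all $i$; it is semi-directed if at least one of these edges is an arrow. A chain graph (CG) is an adicyclic graph, i.e., one with no semi-directed cycles. The skeleton is the graph obtained by forgetting orientations. A triplex $(\{a,c\},b)$ occurs in a graph if $a,c$ are nonadjacent and the induced subgraph on $\{a,b,c\}$ is $a\to b\leftarrow c$ (an immorality), or $a\to b-c$ or $a-b\leftarrow c$ (flags). Two CGs on the same vertex set are AMP Markov equivalent if they determine the same set of distributions under the AMP Markov property; by a known theorem this holds iff they have the same skeleton and the same triplexes, which may be taken as the definition. The AMP essential graph $\mathcal{G}^*$ has the common skeleton of the members of $\mathcal{G}$; an arrow $a\to b$ occurs in $\mathcal{G}^*$ iff $a\to b\in G$ for at least one $G\in\mathcal{G}$ but $a\leftarrow b\in G'$ for no $G'\in\mathcal{G}$; a line $a-b$ occurs in $\mathcal{G}^*$ iff either $a-b\in G$ for every $G\in\mathcal{G}$ (a strong line, written $a\overset{s}{-}b$), or there exist $G,G'\in\mathcal{G}$ with $a\to b\in G$ and $a\leftarrow b\in G'$ (a weak line). An arrow $a\to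 b\in \mathcal{G}^*$ is well protected in $\mathcal{G}^*$ if it occurs in at least one of the following eight configurations as an induced subgraph of $\mathcal{G}^*$ (pairs not listed as adjacent are nonadjacent): (i) $c\to a\to b$, $c,b$ nonadjacent; (ii) $a\to b\leftarrow c$, $a,c$ nonadjacent; (iii) $a\to b$, $a\to c$, $c\to b$; (iv) $a\to b$, $c\to b$, $d\to b$, $a-c$, $a-d$, with $c,d$ distinct and nonadjacent; (v) $a\to b$, $c\to b$, $a\overset{s}{-}c$; (vi) $c\overset{s}{-}a\to b$, $c,b$ nonadjacent; (vii) $a\to b\overset{s}{-}c$, $a,c$ nonadjacent; (viii) $a\to b$, $a\to c$, $b\overset{s}{-}c$. *)

theory Defs
  imports Main
begin

section \<open>Mixed graphs\<close>

text \<open>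
  The pair \<open>(a, b)\<close> in \<open>arrows G\<close> is the arrow from \<open>a\<close> to \<open>b\<close>; a line between \<open>a\<close> and \<open>b\<close> is the
  unordered pair \<open>{a, b}\<close> in \<open>lines G\<close>.
\<close>

record 'a mixed_graph =
  verts :: "'a set"
  arrows :: "('a \<times> 'a) set"
  lines :: "'a set set"

definition mixed_graph :: "'a mixed_graph \<Rightarrow> bool" where
  "mixed_graph G \<longleftrightarrow>
     finite (verts G) \<and>
     arrows G \<subseteq> verts G \<times> verts G \<and>
     (\<forall>e\<in>lines G. e \<subseteq> verts G \<and> card e = 2) \<and>
     (\<forall>a b. (a, b) \<in> arrows G \<longrightarrow> a \<noteq> b \<and> (b, a) \<notin> arrows G \<and> {a, b} \<notin> lines G)"

definition arrow_or_line :: "'a mixed_graph \<Rightarrow> 'a \<Rightarrow> 'a \<Rightarrow> bool" where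
  "arrow_or_line G a b \<longleftrightarrow> (a, b) \<in> arrows G \<or> {a, b} \<in> lines G"

definition skeleton :: "'a mixed_graph \<Rightarrow> 'a set set" where
  "skeleton G = lines G \<union> {{a, b} | a b. (a, b) \<in> arrows G}"

definition induced :: "'a mixed_graph \<Rightarrow> 'a set \<Rightarrow> 'a mixed_graph" where
  "induced G S =
     \<lparr>verts = verts G \<inter> S, arrows = arrows G \<inter> S \<times> S, lines = lines G \<inter> Pow S\<rparr>"


section \<open>Chain graphs\<close>

definition cycle :: "'a mixed_graph \<Rightarrow> nat \<Rightarrow> (nat \<Rightarrow> 'a) \<Rightarrow> bool" where
  "cycle G k v \<longleftrightarrow>
     3 \<le> k \<and> v k = v 0 \<and> inj_on v {..<k} \<and> (\<forall>i\<in>{1..k}. arrow_or_line G (v (i - 1)) (v i))"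

definition semi_directed_cycle :: "'a mixed_graph \<Rightarrow> nat \<Rightarrow> (nat \<Rightarrow> 'a) \<Rightarrow> bool" where
  "semi_directed_cycle G k v \<longleftrightarrow>
     cycle G k v \<and> (\<exists>i\<in>{1..k}. (v (i - 1), v i) \<in> arrows G)"

definition chain_graph :: "'a mixed_graph \<Rightarrow> bool" where
  "chain_graph G \<longleftrightarrow> mixed_graph G \<and> (\<nexists>k v. semi_directed_cycle G k v)"

definition chain_graphs_on :: "'a set \<Rightarrow> 'a mixed_graph set" where
  "chain_graphs_on V = {G. chain_graph G \<and> verts G = V}"


section \<open>AMP Markov equivalence\<close>

text \<open>
  Specifying the whole induced subgraph forces \<open>a\<close> and \<open>c\<close> to be nonadjacent.
\<close>

definition triplexes :: "'a mixed_graph \<Rightarrow> ('a set \<times> 'a) set" where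
  "triplexes G = {({a, c}, b) | a b c. distinct [a, b, c] \<and>
     (induced G {a, b, c} = \<lparr>verts = {a, b, c}, arrows = {(a, b), (c, b)}, lines = {}\<rparr> \<or>
      induced G {a, b, c} = \<lparr>verts = {a, b, c}, arrows = {(a, b)}, lines = {{b, c}}\<rparr> \<or>
      induced G {a, b, c} = \<lparr>verts = {a, b, c}, arrows = {(c, b)}, lines = {{a, b}}\<rparr>)}"

definition amp_equivalence :: "'a set \<Rightarrow> ('a mixed_graph \<times> 'a mixed_graph) set" where
  "amp_equivalence V =
     {(G, H). G \<in> chain_graphs_on V \<and> H \<in> chain_graphs_on V \<and>
              skeleton G = skeleton H \<and> triplexes G = triplexes H}"

lemma equiv_amp_equivalence: "equiv (chain_graphs_on V) (amp_equivalence V)"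
  by (rule equivI) (auto simp: amp_equivalence_def refl_on_def sym_def trans_def)


section \<open>The AMP essential graph\<close>

definition strong_line :: "'a mixed_graph set \<Rightarrow> 'a \<Rightarrow> 'a \<Rightarrow> bool" where
  "strong_line \<G> a b \<longleftrightarrow> (\<forall>G\<in>\<G>. {a, b} \<in> lines G)"

definition weak_line :: "'a mixed_graph set \<Rightarrow> 'a \<Rightarrow> 'a \<Rightarrow> bool" where
  "weak_line \<G> a b \<longleftrightarrow> (\<exists>G\<in>\<G>. (a, b) \<in> arrows G) \<and> (\<exists>G\<in>\<G>. (b, a) \<in> arrows G)"

text \<open>
  All members of an equivalence class have the same vertices, so the union below is their common
  vertex set. That the essential graph also has their common skeleton is
  \<open>skeleton_essential_graph\<close>.
\<close>

definition essential_graph :: "'a mixed_graph set \<Rightarrow> 'a mixed_graph" where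
  "essential_graph \<G> =
     \<lparr>verts = (\<Union>G\<in>\<G>. verts G),
      arrows = {(a, b). (\<exists>G\<in>\<G>. (a, b) \<in> arrows G) \<and> (\<forall>G\<in>\<G>. (b, a) \<notin> arrows G)},
      lines = {{a, b} | a b. strong_line \<G> a b \<or> weak_line \<G> a b}\<rparr>"

lemma amp_class_nonempty:
  assumes "\<G> \<in> chain_graphs_on V // amp_equivalence V"
  shows "\<G> \<noteq> {}"
  using assms in_quotient_imp_non_empty[OF equiv_amp_equivalence] by blast

lemma amp_class_memberD:
  assumes "\<G> \<in> chain_graphs_on V // amp_equivalence V" "G \<in> \<G>" "H \<in> \<G>"
  shows "chain_graph G" "verts G = V" "skeleton G = skeleton H" "triplexes G = triplexes H"
  using quotient_eq_iff[OF equiv_amp_equivalence assms(1,1,2,3)]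
  by (auto simp: amp_equivalence_def chain_graphs_on_def)

lemma verts_essential_graph:
  assumes "\<G> \<in> chain_graphs_on V // amp_equivalence V"
  shows "verts (essential_graph \<G>) = V"
  using amp_class_nonempty[OF assms] amp_class_memberD(2)[OF assms]
  by (auto simp: essential_graph_def)

lemma skeleton_essential_graph:
  assumes "\<G> \<in> chain_graphs_on V // amp_equivalence V" "G \<in> \<G>"
  shows "skeleton (essential_graph \<G>) = skeleton G"
proof (intro equalityI subsetI)
  have sub: "{a, b} \<in> skeleton G" if "(a, b) \<in> arrows H" "H \<in> \<G>" for a b H
    using that amp_class_memberD(3)[OF assms(1) that(2) assms(2)]
    by (auto simp: skeleton_def)
  fix e assume "e \<in> skeleton (essential_graph \<G>)"
  then consider
      a b where "e = {a, b}" "strong_line \<G> a b"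
    | a b H where "e = {a, b}" "(a, b) \<in> arrows H" "H \<in> \<G>"
    unfolding skeleton_def essential_graph_def weak_line_def by auto
  then show "e \<in> skeleton G"
  proof cases
    case 1
    then show ?thesis using assms(2) by (auto simp: strong_line_def skeleton_def)
  next
    case 2
    then show ?thesis using sub by blast
  qed
next
  fix e assume e: "e \<in> skeleton G"
  have "mixed_graph G"
    using amp_class_memberD(1)[OF assms(1,2,2)] by (simp add: chain_graph_def)
  with e obtain a b where ab: "e = {a, b}"
    unfolding skeleton_def mixed_graph_def by (auto simp: card_2_iff)
  have edge: "{a, b} \<in> lines H \<or> (a, b) \<in> arrows H \<or> (b, a) \<in> arrows H" if "H \<in> \<G>" for H
  proof -
    have "{a, b} \<in> skeleton H"
      using e ab amp_class_memberD(3)[OF assms(1) that assms(2)] by simp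
    then show ?thesis by (auto simp: skeleton_def doubleton_eq_iff)
  qed
  show "e \<in> skeleton (essential_graph \<G>)"
  proof (cases "strong_line \<G> a b \<or> weak_line \<G> a b")
    case True
    then show ?thesis using ab unfolding skeleton_def essential_graph_def by auto
  next
    case False
    then have "(a, b) \<in> arrows (essential_graph \<G>) \<or> (b, a) \<in> arrows (essential_graph \<G>)"
      using edge unfolding strong_line_def weak_line_def essential_graph_def by auto
    then show ?thesis using ab unfolding skeleton_def by (auto simp: insert_commute)
  qed
qed


section \<open>Well protected arrows\<close>

text \<open>
  An equation for the induced subgraph cannot tell strong lines from weak ones, so strength is a
  separate conjunct, relative to the class; lines without it may be of either kind.
\<close>

definition well_protected :: "'a mixed_graph set \<Rightarrow> 'a \<Rightarrow> 'a \<Rightarrow> bool" where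
  "well_protected \<G> a b \<longleftrightarrow>
     (let E = essential_graph \<G> in
       (\<exists>c. distinct [a, b, c] \<and> induced E {a, b, c} =
          \<lparr>verts = {a, b, c}, arrows = {(c, a), (a, b)}, lines = {}\<rparr>) \<or>
       (\<exists>c. distinct [a, b, c] \<and> induced E {a, b, c} =
          \<lparr>verts = {a, b, c}, arrows = {(a, b), (c, b)}, lines = {}\<rparr>) \<or>
       (\<exists>c. distinct [a, b, c] \<and> induced E {a, b, c} =
          \<lparr>verts = {a, b, c}, arrows = {(a, b), (a, c), (c, b)}, lines = {}\<rparr>) \<or>
       (\<exists>c d. distinct [a, b, c, d] \<and> induced E {a, b, c, d} =
          \<lparr>verts = {a, b, c, d}, arrows = {(a, b), (c, b), (d, b)}, lines = {{a, c}, {a, d}}\<rparr>) \<or>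
       (\<exists>c. distinct [a, b, c] \<and> strong_line \<G> a c \<and> induced E {a, b, c} =
          \<lparr>verts = {a, b, c}, arrows = {(a, b), (c, b)}, lines = {{a, c}}\<rparr>) \<or>
       (\<exists>c. distinct [a, b, c] \<and> strong_line \<G> a c \<and> induced E {a, b, c} =
          \<lparr>verts = {a, b, c}, arrows = {(a, b)}, lines = {{a, c}}\<rparr>) \<or>
       (\<exists>c. distinct [a, b, c] \<and> strong_line \<G> b c \<and> induced E {a, b, c} =
          \<lparr>verts = {a, b, c}, arrows = {(a, b)}, lines = {{b, c}}\<rparr>) \<or>
       (\<exists>c. distinct [a, b, c] \<and> strong_line \<G> b c \<and> induced E {a, b, c} =
          \<lparr>verts = {a, b, c}, arrows = {(a, b), (a, c)}, lines = {{b, c}}\<rparr>))"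

end

theory Submission
  imports Defs
begin

text \<open>
  Say that the edge between \<open>x\<close> and \<open>y\<close> is blocked at \<open>x\<close> if no member of the class contains the
  arrow from \<open>y\<close> to \<open>x\<close>. The essential graph only records where edges are blocked: an arrow
  \<open>a \<rightarrow> b\<close> is an edge blocked at \<open>a\<close> alone, a strong line is blocked at both ends, and a weak line
  at neither. There are obvious local reasons for \<open>xy\<close> to be blocked at \<open>x\<close>: a triplex at \<open>y\<close>; a
  block at \<open>w\<close> on \<open>wx\<close>, where \<open>w\<close> and \<open>y\<close> are nonadjacent and form no triplex at \<open>x\<close>; a path from
  \<open>x\<close> to \<open>y\<close> through a common neighbour, with both edges blocked at their first vertex; or a kite,
  with two nonadjacent common neighbours of \<open>x\<close> and \<open>y\<close> that form no triplex at \<open>x\<close> and block their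
  edges to \<open>y\<close>, so that an arrow from \<open>y\<close> to \<open>x\<close> would force an immorality at \<open>x\<close>. Sorted by whether
  the other edges are arrows or lines, these reasons are the eight protecting configurations. So
  the theorem says that the local reasons are complete: an edge that is blocked at one end only is
  blocked for a local reason.

  To prove completeness, let \<open>tail\<close> be the inductive closure of these rules and of two rules for
  pairs of strong lines, which cannot conclude anything about an arrow. Call an edge free if the
  rules produce a tail at neither end. The key fact is \<open>tail_propagates\<close>: a tail at \<open>x\<close> on \<open>xy\<close> is
  passed on to \<open>xz\<close> along every free edge \<open>yz\<close>. It implies that the ends of a free path of length
  two are adjacent by a free edge or not at all (\<open>free_induced\<close>), that oriented free edges cannot
  close a semi-directed walk together with derived tails (\<open>oriented_walk_no_return\<close>), and, with the
  rules for strong lines, that the free edges form a chordal graph (\<open>free_chordal\<close>). A chordal graph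
  has a perfect ordering that starts with any prescribed vertex (\<open>ex_perfect_ordering\<close>). Orienting
  the free edges along it, and all other edges as the derived tails say, yields a chain graph with
  the skeleton and the triplexes of the class (\<open>orient_member\<close>). Hence every free edge occurs as an
  arrow in either direction in some member (\<open>free_both_ways\<close>), so an arrow of the essential graph is
  not free. Its tail is then derived, and the last rule of the derivation exhibits one of the
  eight configurations.
\<close>

section \<open>Mixed graphs and chain graphs\<close>

text \<open>
  Turns the equations that define triplexes and protection into facts about single pairs.
\<close>

lemma induced_eq_iff:
  assumes "mixed_graph G" "S \<subseteq> verts G" "A \<subseteq> S \<times> S" "L \<subseteq> {{x, y} | x y. x \<in> S \<and> y \<in> S}"
  shows "induced G S = \<lparr>verts = S, arrows = A, lines = L\<rparr> \<longleftrightarrow>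
    (\<forall>x\<in>S. \<forall>y\<in>S. ((x, y) \<in> arrows G \<longleftrightarrow> (x, y) \<in> A) \<and> ({x, y} \<in> lines G \<longleftrightarrow> {x, y} \<in> L))"
    (is "?l = ?r")
proof
  assume ?l
  then have "arrows G \<inter> S \<times> S = A" "lines G \<inter> Pow S = L"
    by (auto simp: induced_def)
  then show ?r by blast
next
  assume r: ?r
  have "arrows G \<inter> S \<times> S = A" using r assms(3) by auto
  moreover have "lines G \<inter> Pow S = L"
  proof
    show "lines G \<inter> Pow S \<subseteq> L"
    proof
      fix e assume e: "e \<in> lines G \<inter> Pow S"
      then obtain x y where "e = {x, y}"
        using assms(1) by (auto simp: mixed_graph_def card_2_iff)
      then show "e \<in> L" using e r by auto
    qed
    show "L \<subseteq> lines G \<inter> Pow S" using assms(4) r by fastforce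
  qed
  moreover have "verts G \<inter> S = S" using assms(2) by auto
  ultimately show ?l by (simp add: induced_def)
qed

lemma doubleton_in_skeleton:
  "{x, y} \<in> skeleton G \<longleftrightarrow> {x, y} \<in> lines G \<or> (x, y) \<in> arrows G \<or> (y, x) \<in> arrows G"
  by (auto simp: skeleton_def doubleton_eq_iff)

lemma line_verts: "mixed_graph G \<Longrightarrow> {x, y} \<in> lines G \<Longrightarrow> x \<in> verts G \<and> y \<in> verts G \<and> x \<noteq> y"
  unfolding mixed_graph_def by force

lemma arrow_verts: "mixed_graph G \<Longrightarrow> (x, y) \<in> arrows G \<Longrightarrow>
  x \<in> verts G \<and> y \<in> verts G \<and> x \<noteq> y \<and> (y, x) \<notin> arrows G \<and> {x, y} \<notin> lines G \<and> {y, x} \<notin> lines G"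
  unfolding mixed_graph_def by (metis insert_commute mem_Sigma_iff subsetD)

lemma triplex_iff:
  assumes G: "mixed_graph G"
  shows "({a, c}, b) \<in> triplexes G \<longleftrightarrow> a \<noteq> c \<and> {a, c} \<notin> skeleton G \<and>
    arrow_or_line G a b \<and> arrow_or_line G c b \<and> ((a, b) \<in> arrows G \<or> (c, b) \<in> arrows G)"
proof -
  define T where "T x y z \<longleftrightarrow> distinct [x, y, z] \<and>
     (induced G {x, y, z} = \<lparr>verts = {x, y, z}, arrows = {(x, y), (z, y)}, lines = {}\<rparr> \<or>
      induced G {x, y, z} = \<lparr>verts = {x, y, z}, arrows = {(x, y)}, lines = {{y, z}}\<rparr> \<or>
      induced G {x, y, z} = \<lparr>verts = {x, y, z}, arrows = {(z, y)}, lines = {{x, y}}\<rparr>)" for x y z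
  define U where "U x y z \<longleftrightarrow> x \<noteq> z \<and> {x, z} \<notin> skeleton G \<and>
    arrow_or_line G x y \<and> arrow_or_line G z y \<and> ((x, y) \<in> arrows G \<or> (z, y) \<in> arrows G)" for x y z
  have U_sym: "U x y z \<longleftrightarrow> U z y x" for x y z
    unfolding U_def by (auto simp: insert_commute)
  have TU: "T x y z \<longleftrightarrow> U x y z" for x y z
  proof (cases "{x, y, z} \<subseteq> verts G \<and> distinct [x, y, z]")
    case True
    have no_loops: "(u, u) \<notin> arrows G" "{u} \<notin> lines G" for u
      using line_verts[OF G, of u u] arrow_verts[OF G, of u u] by auto
    have asym: "(u, w) \<notin> arrows G \<or> (w, u) \<notin> arrows G" "(u, w) \<notin> arrows G \<or> {u, w} \<notin> lines G"
      "(u, w) \<notin> arrows G \<or> {w, u} \<notin> lines G" for u w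
      using arrow_verts[OF G, of u w] by auto
    have verts: "{x, y, z} \<subseteq> verts G" and distinct: "x \<noteq> y" "y \<noteq> z" "x \<noteq> z"
      using True by auto
    have comm: "{y, x} = {x, y}" "{z, y} = {y, z}" "{z, x} = {x, z}" by auto
    have neq: "{x, y} \<noteq> {y, z}" "{x, y} \<noteq> {x, z}" "{y, z} \<noteq> {x, z}" "{y, z} \<noteq> {x, y}"
      "{x, z} \<noteq> {x, y}" "{x, z} \<noteq> {y, z}" "\<And>u. {u} \<noteq> {x, y}" "\<And>u. {u} \<noteq> {y, z}" "\<And>u. {u} \<noteq> {x, z}"
      using distinct by (auto simp: doubleton_eq_iff)
    have immorality: "induced G {x, y, z} = \<lparr>verts = {x, y, z}, arrows = {(x, y), (z, y)}, lines = {}\<rparr> \<longleftrightarrow>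
        (x, y) \<in> arrows G \<and> (z, y) \<in> arrows G \<and> {x, z} \<notin> skeleton G"
      using asym[of x y] asym[of z y]
      by (subst induced_eq_iff[OF G verts])
         (auto simp: distinct comm neq no_loops doubleton_in_skeleton)
    have flag: "induced G {x, y, z} = \<lparr>verts = {x, y, z}, arrows = {(x, y)}, lines = {{y, z}}\<rparr> \<longleftrightarrow>
        (x, y) \<in> arrows G \<and> {y, z} \<in> lines G \<and> {x, z} \<notin> skeleton G"
      using asym[of x y] asym[of y z] asym[of z y]
      by (subst induced_eq_iff[OF G verts])
         (auto simp: distinct comm neq no_loops doubleton_in_skeleton)
    have flag': "induced G {x, y, z} = \<lparr>verts = {x, y, z}, arrows = {(z, y)}, lines = {{x, y}}\<rparr> \<longleftrightarrow>
        (z, y) \<in> arrows G \<and> {x, y} \<in> lines G \<and> {x, z} \<notin> skeleton G"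
      using asym[of z y] asym[of x y] asym[of y x]
      by (subst induced_eq_iff[OF G verts])
         (auto simp: distinct comm neq no_loops doubleton_in_skeleton)
    show ?thesis
      unfolding T_def U_def immorality flag flag' arrow_or_line_def comm
      using distinct by auto
  next
    case False
    have "\<not> T x y z"
    proof
      assume T: "T x y z"
      then have "verts (induced G {x, y, z}) = {x, y, z}"
        unfolding T_def by (elim conjE disjE) simp_all
      then show False using T False by (auto simp: T_def induced_def)
    qed
    moreover have "\<not> U x y z"
      using False line_verts[OF G] arrow_verts[OF G] unfolding U_def arrow_or_line_def by auto
    ultimately show ?thesis by simp
  qed
  have "({a, c}, b) \<in> triplexes G \<longleftrightarrow> T a b c \<or> T c b a"
    unfolding triplexes_def T_def by (simp add: doubleton_eq_iff) blast
  then show ?thesis using TU U_sym U_def by metis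
qed

lemma shortest_walk:
  assumes "(x, y) \<in> Q\<^sup>*"
  obtains n f where "f 0 = x" "f n = y" "\<And>i. i < n \<Longrightarrow> (f i, f (Suc i)) \<in> Q"
    "\<And>i j. i < j \<Longrightarrow> j \<le> n \<Longrightarrow> f i \<noteq> f j" "\<And>i j. Suc i < j \<Longrightarrow> j \<le> n \<Longrightarrow> (f i, f j) \<notin> Q"
proof -
  define n where "n = (LEAST n. (x, y) \<in> Q ^^ n)"
  have n: "(x, y) \<in> Q ^^ n" unfolding n_def using rtrancl_imp_relpow[OF assms] by (metis LeastI)
  have least: "n \<le> m" if "(x, y) \<in> Q ^^ m" for m
    unfolding n_def using that by (rule Least_le)
  obtain f where f: "f 0 = x" "f n = y" and step: "\<And>i. i < n \<Longrightarrow> (f i, f (Suc i)) \<in> Q"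
    using n unfolding relpow_fun_conv by blast
  have seg: "(f i, f j) \<in> Q ^^ (j - i)" if "i \<le> j" "j \<le> n" for i j
    unfolding relpow_fun_conv using that step by (intro exI[of _ "\<lambda>k. f (i + k)"]) auto
  have splice: "n \<le> i + (k + (n - j))" if "i \<le> j" "j \<le> n" "(f i, f j) \<in> Q ^^ k" for i j k
  proof (rule least)
    have "(x, f i) \<in> Q ^^ i" "(f j, y) \<in> Q ^^ (n - j)"
      using seg[of 0 i] seg[of j n] f that by auto
    then show "(x, y) \<in> Q ^^ (i + (k + (n - j)))"
      unfolding relpow_add using that(3) by blast
  qed
  show thesis
  proof (rule that[of f n])
    show "f i \<noteq> f j" if "i < j" "j \<le> n" for i j
      using splice[of i j 0] that by auto
    show "(f i, f j) \<notin> Q" if "Suc i < j" "j \<le> n" for i j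
      using splice[of i j 1] that by auto
  qed (use f step in auto)
qed

text \<open>
  A shortest return walk has distinct vertices, so closing it by the arrow gives a cycle in the strict
  sense. Together with \<open>chain_graphI\<close> this lets later arguments speak of walks only.
\<close>

lemma chain_graph_no_semi_directed_closed_walk:
  assumes G: "chain_graph G" and xy: "(x, y) \<in> arrows G"
    and ret: "(y, x) \<in> {(u, v). arrow_or_line G u v}\<^sup>*"
  shows False
proof -
  let ?Q = "{(u, v). arrow_or_line G u v}"
  have mixed: "mixed_graph G" using G by (simp add: chain_graph_def)
  obtain n f where f: "f 0 = y" "f n = x" "\<And>i. i < n \<Longrightarrow> (f i, f (Suc i)) \<in> ?Q"
      and inj: "\<And>i j. i < j \<Longrightarrow> j \<le> n \<Longrightarrow> f i \<noteq> f j"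
    using shortest_walk[OF ret] by metis
  have "n \<noteq> 0" using f(1,2) arrow_verts[OF mixed xy] by metis
  moreover have "n \<noteq> 1"
    using f(1,2) f(3)[of 0] arrow_verts[OF mixed xy] by (auto simp: arrow_or_line_def)
  ultimately have n2: "2 \<le> n" by simp
  let ?v = "\<lambda>i. if i = Suc n then y else f i"
  have "semi_directed_cycle G (Suc n) ?v"
    unfolding semi_directed_cycle_def cycle_def
  proof (intro conjI ballI)
    show "3 \<le> Suc n" using n2 by simp
    show "?v (Suc n) = ?v 0" using f(1) by simp
    show "inj_on ?v {..<Suc n}"
      using inj by (auto intro!: linorder_inj_onI')
    show "arrow_or_line G (?v (i - 1)) (?v i)" if i: "i \<in> {1..Suc n}" for i
    proof (cases "i = Suc n")
      case True
      then show ?thesis using f(2) xy by (simp add: arrow_or_line_def)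
    next
      case False
      then show ?thesis using f(3)[of "i - 1"] i by auto
    qed
    show "\<exists>i\<in>{1..Suc n}. (?v (i - 1), ?v i) \<in> arrows G"
      using f(2) xy by (intro bexI[of _ "Suc n"]) auto
  qed
  then show False using G by (auto simp: chain_graph_def)
qed


lemma chain_graphI:
  assumes G: "mixed_graph G"
    and no_return: "\<And>x y. (x, y) \<in> arrows G \<Longrightarrow> (y, x) \<notin> {(u, v). arrow_or_line G u v}\<^sup>*"
  shows "chain_graph G"
  unfolding chain_graph_def
proof (intro conjI notI)
  let ?Q = "{(u, v). arrow_or_line G u v}"
  assume "\<exists>k v. semi_directed_cycle G k v"
  then obtain k v where "semi_directed_cycle G k v" by blast
  then have closed: "v k = v 0" and edge: "\<forall>i\<in>{1..k}. arrow_or_line G (v (i - 1)) (v i)"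
      and arrow: "\<exists>i\<in>{1..k}. (v (i - 1), v i) \<in> arrows G"
    unfolding semi_directed_cycle_def cycle_def by blast+
  have walk: "(v i, v j) \<in> ?Q\<^sup>*" if "i \<le> j" "j \<le> k" for i j
    using that
  proof (induction j rule: dec_induct)
    case (step j)
    have "(v i, v j) \<in> ?Q\<^sup>*" "(v j, v (Suc j)) \<in> ?Q"
      using step edge[rule_format, of "Suc j"] by simp_all
    then show ?case by (rule rtrancl.rtrancl_into_rtrancl)
  qed simp
  obtain i where i: "i \<in> {1..k}" "(v (i - 1), v i) \<in> arrows G" using arrow by blast
  have "(v i, v k) \<in> ?Q\<^sup>*" "(v 0, v (i - 1)) \<in> ?Q\<^sup>*"
    using walk[of i k] walk[of 0 "i - 1"] i(1) by auto
  then have "(v i, v (i - 1)) \<in> ?Q\<^sup>*" unfolding closed by (rule rtrancl_trans)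
  then show False using no_return[OF i(2)] by simp
qed (rule G)


section \<open>Perfect orderings of chordal graphs\<close>

text \<open>
  A loop of this relation on directed edges is a closed walk in which vertices two steps apart are
  distinct and nonadjacent; chordless cycles of length at least four are such walks. Acyclicity of
  the relation therefore serves as chordality, and no cycles need to be handled.
\<close>

definition chordless_step :: "('a \<Rightarrow> 'a \<Rightarrow> bool) \<Rightarrow> (('a \<times> 'a) \<times> 'a \<times> 'a) set" where
  "chordless_step adj = {((u, v), (v, w)) | u v w. adj u v \<and> adj v w \<and> u \<noteq> w \<and> \<not> adj u w}"

definition simplicial :: "('a \<Rightarrow> 'a \<Rightarrow> bool) \<Rightarrow> 'a set \<Rightarrow> 'a \<Rightarrow> bool" where
  "simplicial adj A s \<longleftrightarrow> s \<in> A \<and>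
    (\<forall>x\<in>A. \<forall>y\<in>A. adj s x \<longrightarrow> adj s y \<longrightarrow> x \<noteq> y \<longrightarrow> adj x y)"

text \<open>
  The walk may only pass through \<open>C\<close>; on a shortest one, every two consecutive edges are chordless.
\<close>

lemma shortest_walk_chordless:
  assumes xy: "x \<noteq> y" "\<not> adj x y" "x \<notin> C" "y \<notin> C"
    and walk: "(x, y) \<in> {(p, q). adj p q \<and> (p \<in> C \<or> p = x) \<and> (q \<in> C \<or> q = y)}\<^sup>*"
  obtains c d where "c \<in> C" "d \<in> C" "adj x c" "adj d y" "((x, c), (d, y)) \<in> (chordless_step adj)\<^sup>*"
proof -
  let ?Q = "{(p, q). adj p q \<and> (p \<in> C \<or> p = x) \<and> (q \<in> C \<or> q = y)}"
  obtain n f where f: "f 0 = x" "f n = y" and step: "\<And>i. i < n \<Longrightarrow> (f i, f (Suc i)) \<in> ?Q"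
      and distinct: "\<And>i j. i < j \<Longrightarrow> j \<le> n \<Longrightarrow> f i \<noteq> f j"
      and no_shortcut: "\<And>i j. Suc i < j \<Longrightarrow> j \<le> n \<Longrightarrow> (f i, f j) \<notin> ?Q"
    by (rule shortest_walk[OF walk]) (rule that)
  have chordless: "f i \<noteq> f (Suc (Suc i)) \<and> \<not> adj (f i) (f (Suc (Suc i)))" if "Suc (Suc i) \<le> n" for i
    using step[of i] step[of "Suc i"] distinct[of i "Suc (Suc i)"] no_shortcut[of i "Suc (Suc i)"] that
    by simp
  have "n \<noteq> 0" using f xy(1) by metis
  moreover have "n \<noteq> 1"
  proof
    assume "n = 1"
    then have "adj (f 0) (f n)" using step[of 0] by simp
    then show False using f xy(2) by simp
  qed
  ultimately have n2: "2 \<le> n" by simp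
  have along: "((f 0, f 1), (f i, f (Suc i))) \<in> (chordless_step adj)\<^sup>*" if "i < n" for i
    using that
  proof (induction i)
    case (Suc i)
    have "((f i, f (Suc i)), (f (Suc i), f (Suc (Suc i)))) \<in> chordless_step adj"
      using step[of i] step[of "Suc i"] chordless[of i] Suc.prems by (auto simp: chordless_step_def)
    then show ?case using Suc by (auto intro: rtrancl.rtrancl_into_rtrancl)
  qed simp
  obtain m where m: "n = Suc m" using n2 by (cases n) auto
  show thesis
  proof (rule that[of "f 1" "f m"])
    have "f i \<in> C" if "0 < i" "i < n" for i
    proof -
      have "f i \<noteq> x" using distinct[of 0 i] that f(1) by auto
      then show ?thesis using step[OF that(2)] by auto
    qed
    then show "f 1 \<in> C" "f m \<in> C" using n2 m by auto
    show "adj x (f 1)" using step[of 0] n2 f(1) by simp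
    show "adj (f m) y" using step[of m] m f(2) by simp
    show "((x, f 1), (f m, y)) \<in> (chordless_step adj)\<^sup>*" using along[of m] m f by simp
  qed
qed

text \<open>
  This is Dirac's argument. Let \<open>C\<close> be a connected component of the vertices that are neither \<open>v\<close> nor
  adjacent to \<open>v\<close>, and \<open>S\<close> the set of vertices outside \<open>C\<close> with a neighbour in \<open>C\<close>. All of \<open>S\<close> is
  adjacent to \<open>v\<close>. It is a clique, because nonadjacent \<open>x\<close> and \<open>y\<close> in \<open>S\<close> could be joined by a shortest
  walk through \<open>C\<close>, which \<open>v\<close> closes to a chordless cycle. Apply the induction hypothesis to
  \<open>C \<union> S\<close>, with a vertex \<open>t\<close> in the role of \<open>v\<close> that is equal or adjacent to everything in \<open>S\<close>: the
  simplicial vertex found is then in \<open>C\<close>, and all its neighbours lie in \<open>C \<union> S\<close>. If no vertex of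
  \<open>C \<union> S\<close> has a nonneighbour there, every vertex of \<open>C\<close> is simplicial.
\<close>

lemma ex_simplicial_nonneighbour:
  assumes sym: "\<And>x y. adj x y \<Longrightarrow> adj y x" and chordal: "acyclic (chordless_step adj)"
  shows "finite A \<Longrightarrow> v \<in> A \<Longrightarrow> \<exists>u\<in>A. u \<noteq> v \<and> \<not> adj v u \<Longrightarrow>
    \<exists>s. simplicial adj A s \<and> s \<noteq> v \<and> \<not> adj v s"
proof (induction A arbitrary: v rule: finite_psubset_induct)
  case (psubset A)
  define F where "F = {u \<in> A. u \<noteq> v \<and> \<not> adj v u}"
  obtain u where u: "u \<in> F" using psubset.prems by (auto simp: F_def)
  define Q where "Q = {(p, q). adj p q \<and> p \<in> F \<and> q \<in> F}"
  define C where "C = {c. (u, c) \<in> Q\<^sup>*}"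
  define S where "S = {s \<in> A. s \<notin> C \<and> (\<exists>c\<in>C. adj s c)}"
  have CF: "C \<subseteq> F"
  proof
    fix c assume "c \<in> C"
    then have "(u, c) \<in> Q\<^sup>*" by (simp add: C_def)
    then show "c \<in> F" by (induction rule: rtrancl_induct) (use u in \<open>auto simp: Q_def\<close>)
  qed
  have S_nbr: "adj v s" if s: "s \<in> S" for s
  proof (rule ccontr)
    assume "\<not> adj v s"
    obtain c where c: "c \<in> C" "adj s c" using s by (auto simp: S_def)
    have "s \<noteq> v" using c CF by (auto simp: F_def)
    then have "s \<in> F" using \<open>\<not> adj v s\<close> that by (auto simp: F_def S_def)
    then have "(c, s) \<in> Q" using c CF sym by (auto simp: Q_def)
    then have "s \<in> C" using c by (auto simp: C_def intro: rtrancl.rtrancl_into_rtrancl)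
    then show False using that by (simp add: S_def)
  qed
  have S_clique: "adj x y" if S: "x \<in> S" "y \<in> S" and "x \<noteq> y" for x y
  proof (rule ccontr)
    assume xy: "\<not> adj x y"
    obtain c d where c: "c \<in> C" "adj x c" and d: "d \<in> C" "adj y d"
      using S by (auto simp: S_def)
    let ?P = "{(p, q). adj p q \<and> (p \<in> C \<or> p = x) \<and> (q \<in> C \<or> q = y)}"
    let ?R = "{(p, q). adj p q \<and> p \<in> C \<and> q \<in> C}"
    have "sym ?R" using sym by (auto simp: sym_def)
    have reach: "(u, e) \<in> ?R\<^sup>*" if "e \<in> C" for e
    proof -
      have "(u, e) \<in> Q\<^sup>*" using that by (simp add: C_def)
      then show ?thesis
      proof (induction rule: rtrancl_induct)
        case (step y z)
        then have "y \<in> C" "z \<in> C" by (auto simp: C_def intro: rtrancl.rtrancl_into_rtrancl)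
        then have "(y, z) \<in> ?R" using step by (auto simp: Q_def)
        then show ?case using step.IH by (rule rtrancl.rtrancl_into_rtrancl[rotated])
      qed simp
    qed
    have "(c, d) \<in> ?R\<^sup>*"
      using reach[OF c(1)] reach[OF d(1)] sym_rtrancl[OF \<open>sym ?R\<close>] by (meson rtrancl_trans symD)
    then have "(c, d) \<in> ?P\<^sup>*" by (rule rtrancl_mono[THEN subsetD, rotated]) auto
    moreover have "(x, c) \<in> ?P" "(d, y) \<in> ?P" using c d sym by auto
    ultimately have "(x, y) \<in> ?P\<^sup>*" by (meson converse_rtrancl_into_rtrancl rtrancl.rtrancl_into_rtrancl)
    moreover have "x \<notin> C" "y \<notin> C" using S by (auto simp: S_def)
    ultimately obtain c' d' where w: "c' \<in> C" "d' \<in> C" "adj x c'" "adj d' y"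
        "((x, c'), (d', y)) \<in> (chordless_step adj)\<^sup>*"
      using shortest_walk_chordless[of x y adj C] \<open>x \<noteq> y\<close> xy by blast
    have "v \<noteq> c'" "\<not> adj v c'" "v \<noteq> d'" "\<not> adj d' v" using w CF sym by (auto simp: F_def)
    then have "((v, x), (x, c')) \<in> chordless_step adj" "((d', y), (y, v)) \<in> chordless_step adj"
        "((y, v), (v, x)) \<in> chordless_step adj"
      using w S_nbr S \<open>x \<noteq> y\<close> xy sym by (auto simp: chordless_step_def)
    then have "((v, x), (v, x)) \<in> (chordless_step adj)\<^sup>+"
      using w(5) by (meson rtrancl_into_trancl2 rtrancl_into_trancl1 trancl.trancl_into_trancl)
    then show False using chordal by (simp add: acyclic_def)
  qed
  define B where "B = C \<union> S"
  have nbrs: "y \<in> B" if "c \<in> C" "y \<in> A" "adj c y" for c y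
    using that sym by (auto simp: B_def S_def)
  have lift: "simplicial adj A s" if "s \<in> C" "simplicial adj B s" for s
    using that nbrs CF unfolding simplicial_def F_def by blast
  have "B \<subset> A" using CF psubset.prems S_nbr by (auto simp: B_def S_def F_def)
  have uC: "u \<in> C" by (simp add: C_def)
  show ?case
  proof (cases "\<exists>t\<in>B. \<exists>z\<in>B. z \<noteq> t \<and> \<not> adj t z")
    case False
    then have "\<And>x y. x \<in> B \<Longrightarrow> y \<in> B \<Longrightarrow> x \<noteq> y \<Longrightarrow> adj x y" by metis
    then have "simplicial adj B u" using uC by (simp add: simplicial_def B_def)
    then show ?thesis using lift uC u by (auto simp: F_def)
  next
    case True
    \<comment> \<open>If no vertex of \<open>S\<close> has a nonneighbour in \<open>B\<close>, a vertex of \<open>C\<close> can serve as \<open>t\<close>.\<close>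
    have "\<exists>t\<in>B. (\<exists>z\<in>B. z \<noteq> t \<and> \<not> adj t z) \<and> (\<forall>s\<in>S. s = t \<or> adj t s)"
    proof (cases "\<exists>t\<in>S. \<exists>z\<in>B. z \<noteq> t \<and> \<not> adj t z")
      case True
      then show ?thesis using S_clique unfolding B_def by blast
    next
      case False
      obtain t z where t: "t \<in> B" "z \<in> B" "z \<noteq> t" "\<not> adj t z" using True by blast
      have "adj t s" if "s \<in> S" "s \<noteq> t" for s
        using False that t(1) sym[of s t] by metis
      then show ?thesis using t by metis
    qed
    then obtain t where t: "t \<in> B" "\<exists>z\<in>B. z \<noteq> t \<and> \<not> adj t z" "\<forall>s\<in>S. s = t \<or> adj t s" by blast
    then obtain s where s: "simplicial adj B s" "s \<noteq> t" "\<not> adj t s"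
      using psubset.IH[OF \<open>B \<subset> A\<close>] by blast
    then have "s \<in> C" using t(3) by (auto simp: simplicial_def B_def)
    then show ?thesis using lift[OF _ s(1)] CF by (auto simp: F_def)
  qed
qed

lemma ex_simplicial:
  assumes sym: "\<And>x y. adj x y \<Longrightarrow> adj y x" and chordal: "acyclic (chordless_step adj)"
    and "finite A" "A \<noteq> {}"
  shows "\<exists>s. simplicial adj A s"
proof (cases "\<exists>v\<in>A. \<exists>u\<in>A. u \<noteq> v \<and> \<not> adj v u")
  case True
  then show ?thesis using ex_simplicial_nonneighbour[of adj A, OF sym chordal assms(3)] by blast
next
  case False
  obtain a where "a \<in> A" using assms(4) by blast
  then have "simplicial adj A a" using False unfolding simplicial_def by metis
  then show ?thesis ..
qed

definition perfect_ordering :: "('a \<Rightarrow> 'a \<Rightarrow> bool) \<Rightarrow> 'a set \<Rightarrow> ('a \<Rightarrow> nat) \<Rightarrow> bool" where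
  "perfect_ordering adj A f \<longleftrightarrow> inj_on f A \<and>
    (\<forall>x\<in>A. \<forall>y\<in>A. \<forall>z\<in>A. adj x y \<longrightarrow> adj z y \<longrightarrow> f x < f y \<longrightarrow> f z < f y \<longrightarrow> x \<noteq> z \<longrightarrow> adj x z)"

text \<open>
  Remove a simplicial vertex other than \<open>r\<close> and place it last. If \<open>r\<close> is adjacent to all other
  vertices, a vertex that is simplicial after the removal of \<open>r\<close> is simplicial with \<open>r\<close> as well;
  otherwise a simplicial nonneighbour of \<open>r\<close> exists.
\<close>

lemma ex_perfect_ordering:
  assumes sym: "\<And>x y. adj x y \<Longrightarrow> adj y x" and chordal: "acyclic (chordless_step adj)"
  shows "finite A \<Longrightarrow> r \<in> A \<Longrightarrow> \<exists>f. perfect_ordering adj A f \<and> (\<forall>x\<in>A. x \<noteq> r \<longrightarrow> f r < f x)"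
proof (induction A rule: finite_psubset_induct)
  case (psubset A)
  show ?case
  proof (cases "A = {r}")
    case True
    then show ?thesis by (auto simp: perfect_ordering_def)
  next
    case False
    have "\<exists>s. simplicial adj A s \<and> s \<noteq> r"
    proof (cases "\<exists>u\<in>A. u \<noteq> r \<and> \<not> adj r u")
      case True
      then show ?thesis
        using ex_simplicial_nonneighbour[of adj A, OF sym chordal psubset.hyps psubset.prems] by blast
    next
      case False
      have "A - {r} \<noteq> {}" using \<open>A \<noteq> {r}\<close> psubset.prems by auto
      then obtain s where "simplicial adj (A - {r}) s"
        using ex_simplicial[of adj "A - {r}", OF sym chordal] psubset.hyps by blast
      then have s: "s \<in> A" "s \<noteq> r"
          and clique: "\<And>x y. \<lbrakk>x \<in> A - {r}; y \<in> A - {r}; adj s x; adj s y; x \<noteq> y\<rbrakk> \<Longrightarrow> adj x y"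
        by (auto simp: simplicial_def)
      have "adj x y" if "x \<in> A" "y \<in> A" "adj s x" "adj s y" "x \<noteq> y" for x y
      proof (cases "x = r \<or> y = r")
        case True
        then show ?thesis using False sym that by metis
      next
        case False
        then show ?thesis using clique that by simp
      qed
      then show ?thesis using s unfolding simplicial_def by blast
    qed
    then obtain s where s: "simplicial adj A s" "s \<noteq> r" by blast
    then have sA: "s \<in> A" by (simp add: simplicial_def)
    then have "A - {s} \<subset> A" "r \<in> A - {s}" using s psubset.prems by auto
    then obtain f where perfect: "perfect_ordering adj (A - {s}) f"
        and first: "\<forall>x\<in>A - {s}. x \<noteq> r \<longrightarrow> f r < f x"
      using psubset.IH by meson
    define M where "M = Suc (Max (f ` A))"
    have M: "f x < M" if "x \<in> A" for x
      using that psubset.hyps by (auto simp: M_def less_Suc_eq_le)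
    define g where "g = f(s := M)"
    have g: "g s = M" "\<And>x. x \<noteq> s \<Longrightarrow> g x = f x" by (auto simp: g_def)
    have below: "g x < g s" if "x \<in> A" "x \<noteq> s" for x
      using M g that by auto
    have "inj_on g A"
    proof (rule inj_onI)
      fix x y assume xy: "x \<in> A" "y \<in> A" "g x = g y"
      then have "x = s \<longleftrightarrow> y = s" using below[of x] below[of y] by (metis less_irrefl)
      then show "x = y" using xy perfect g(2) unfolding perfect_ordering_def
        by (cases "x = s") (auto dest: inj_onD)
    qed
    moreover have "g r < g x" if "x \<in> A" "x \<noteq> r" for x
      using first below psubset.prems g(2) s(2) that by (cases "x = s") auto
    moreover have "adj x z" if "x \<in> A" "y \<in> A" "z \<in> A" "adj x y" "adj z y" "g x < g y" "g z < g y" "x \<noteq> z"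
      for x y z
    proof (cases "y = s")
      case True
      then show ?thesis using s(1) that sym unfolding simplicial_def by blast
    next
      case False
      then have "g y < g s" using below that by simp
      then have "x \<noteq> s" "z \<noteq> s" using that by auto
      then show ?thesis using perfect[unfolded perfect_ordering_def, THEN conjunct2, rule_format, of x y z]
          that g(2) False by simp
    qed
    ultimately have "perfect_ordering adj A g" "\<forall>x\<in>A. x \<noteq> r \<longrightarrow> g r < g x"
      unfolding perfect_ordering_def by blast+
    then show ?thesis by blast
  qed
qed


section \<open>Forced tails\<close>

locale amp_class =
  fixes V :: "'a set" and \<G> :: "'a mixed_graph set"
  assumes amp_class: "\<G> \<in> chain_graphs_on V // amp_equivalence V"
begin

definition adj :: "'a \<Rightarrow> 'a \<Rightarrow> bool" where
  "adj x y \<longleftrightarrow> (\<exists>G\<in>\<G>. {x, y} \<in> skeleton G)"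

definition triplex :: "'a \<Rightarrow> 'a \<Rightarrow> 'a \<Rightarrow> bool" where
  "triplex x y z \<longleftrightarrow> (\<exists>G\<in>\<G>. ({x, z}, y) \<in> triplexes G)"

text \<open>
  A derivation of \<open>tail x y\<close> is a local reason why no member of the class contains the arrow from \<open>y\<close>
  to \<open>x\<close>. The first four rules mirror the protecting configurations. In the kite, an arrow from \<open>y\<close>
  to \<open>x\<close> would make \<open>c\<close> and \<open>d\<close> parents of \<open>x\<close>, hence a triplex there. The last two rules cover both edges, and both ends
  of each, of two adjoining strong lines with nonadjacent outer ends. They are there for chordless cycles
  that are undirected in every member: the other rules can leave such cycles free, and the free
  edges could then not be oriented. Their premises make \<open>xy\<close> a strong line, so they never derive a
  tail on an arrow of the essential graph.
\<close>

inductive tail :: "'a \<Rightarrow> 'a \<Rightarrow> bool" where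
  triplex: "triplex x y w \<Longrightarrow> tail x y"
| no_triplex: "tail w x \<Longrightarrow> adj x y \<Longrightarrow> w \<noteq> y \<Longrightarrow> \<not> adj w y \<Longrightarrow> \<not> triplex w x y \<Longrightarrow> tail x y"
| triangle: "tail x w \<Longrightarrow> tail w y \<Longrightarrow> adj x y \<Longrightarrow> tail x y"
| kite: "tail c y \<Longrightarrow> tail d y \<Longrightarrow> adj x y \<Longrightarrow> adj x c \<Longrightarrow> adj x d \<Longrightarrow> c \<noteq> d \<Longrightarrow> \<not> adj c d \<Longrightarrow>
    \<not> triplex c x d \<Longrightarrow> tail x y"
| strong_out: "strong_line \<G> x y \<Longrightarrow> strong_line \<G> y w \<Longrightarrow> x \<noteq> w \<Longrightarrow> \<not> adj x w \<Longrightarrow> tail x y"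
| strong_in: "strong_line \<G> x y \<Longrightarrow> strong_line \<G> x w \<Longrightarrow> y \<noteq> w \<Longrightarrow> \<not> adj y w \<Longrightarrow> tail x y"

definition free :: "'a \<Rightarrow> 'a \<Rightarrow> bool" where
  "free x y \<longleftrightarrow> adj x y \<and> \<not> tail x y \<and> \<not> tail y x"

lemma nonempty: "\<exists>G. G \<in> \<G>"
  using amp_class_nonempty[OF amp_class] by blast

lemma member:
  assumes "G \<in> \<G>"
  shows "chain_graph G" "mixed_graph G" "verts G = V"
  using amp_class_memberD[OF amp_class assms assms] by (auto simp: chain_graph_def)

lemma adj_iff: "G \<in> \<G> \<Longrightarrow> adj x y \<longleftrightarrow> {x, y} \<in> skeleton G"
  using amp_class_memberD(3)[OF amp_class] unfolding adj_def by blast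

lemma triplex_member_iff:
  assumes "G \<in> \<G>"
  shows "triplex x y z \<longleftrightarrow> x \<noteq> z \<and> \<not> adj x z \<and>
    arrow_or_line G x y \<and> arrow_or_line G z y \<and> ((x, y) \<in> arrows G \<or> (z, y) \<in> arrows G)"
proof -
  have "triplex x y z \<longleftrightarrow> ({x, z}, y) \<in> triplexes G"
    using amp_class_memberD(4)[OF amp_class _ assms] assms unfolding triplex_def by blast
  then show ?thesis using triplex_iff[OF member(2)[OF assms]] adj_iff[OF assms] by simp
qed

lemma adj_sym: "adj x y \<Longrightarrow> adj y x"
  by (simp add: adj_def insert_commute)

lemma triplex_sym: "triplex x y z \<Longrightarrow> triplex z y x"
  by (simp add: triplex_def insert_commute)

lemma adj_cases:
  assumes "adj x y" "G \<in> \<G>"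
  obtains "arrow_or_line G x y" "(y, x) \<notin> arrows G" | "(y, x) \<in> arrows G" "\<not> arrow_or_line G x y"
  using assms adj_iff arrow_verts[OF member(2)[OF assms(2)]] unfolding arrow_or_line_def
  by (metis doubleton_in_skeleton)

lemma arrow_or_line_adj: "arrow_or_line G x y \<Longrightarrow> G \<in> \<G> \<Longrightarrow> adj x y"
  by (auto simp: adj_iff doubleton_in_skeleton arrow_or_line_def)

lemma adj_verts: "adj x y \<Longrightarrow> x \<in> V \<and> y \<in> V \<and> x \<noteq> y"
  using nonempty adj_iff doubleton_in_skeleton member(2,3) arrow_verts line_verts by metis

lemma triplex_adj: "triplex x y z \<Longrightarrow> adj x y \<and> adj z y \<and> x \<noteq> z \<and> \<not> adj x z"
  using nonempty triplex_member_iff arrow_or_line_adj by blast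

lemma strong_line_adj: "strong_line \<G> x y \<Longrightarrow> adj x y"
  using nonempty by (auto simp: strong_line_def adj_iff doubleton_in_skeleton)

lemma strong_line_sym: "strong_line \<G> x y \<Longrightarrow> strong_line \<G> y x"
  by (simp add: strong_line_def insert_commute)

lemma tail_adj: "tail x y \<Longrightarrow> adj x y"
  by (cases rule: tail.cases) (auto dest: triplex_adj strong_line_adj)

lemma member_no_semi_directed_triangle:
  assumes "G \<in> \<G>" "arrow_or_line G x y" "arrow_or_line G y z" "arrow_or_line G z x"
  shows "(x, y) \<notin> arrows G"
proof
  assume xy: "(x, y) \<in> arrows G"
  have "(y, z) \<in> {(u, v). arrow_or_line G u v}" "(z, x) \<in> {(u, v). arrow_or_line G u v}"
    using assms by auto
  then have "(y, x) \<in> {(u, v). arrow_or_line G u v}\<^sup>*"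
    by (rule converse_rtrancl_into_rtrancl[OF _ r_into_rtrancl])
  then show False
    by (rule chain_graph_no_semi_directed_closed_walk[OF member(1)[OF assms(1)] xy])
qed

text \<open>
  The only way to avoid a triplex behind an arrow is to continue it.
\<close>

lemma no_triplex_arrow:
  assumes "G \<in> \<G>" "\<not> triplex x y z" "x \<noteq> z" "\<not> adj x z" "(x, y) \<in> arrows G" "adj y z"
  shows "(y, z) \<in> arrows G"
  using assms(6,1)
proof (cases rule: adj_cases)
  case 1
  then show ?thesis using assms triplex_member_iff[OF assms(1), of x y z]
    by (auto simp: arrow_or_line_def insert_commute)
next
  case 2
  then show ?thesis using assms triplex_member_iff[OF assms(1), of x y z]
    by (auto simp: arrow_or_line_def)
qed

lemma tail_sound: "tail x y \<Longrightarrow> G \<in> \<G> \<Longrightarrow> arrow_or_line G x y"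
proof (induction rule: tail.induct)
  case (triplex x y w)
  then show ?case using triplex_member_iff by blast
next
  case (no_triplex w x y)
  from no_triplex.hyps(2) no_triplex.prems show ?case
  proof (cases rule: adj_cases)
    case 2
    then show ?thesis using no_triplex triplex_member_iff[OF no_triplex.prems, of w x y]
      by (auto simp: arrow_or_line_def)
  qed
next
  case (triangle x w y)
  from triangle.hyps(3) triangle.prems show ?case
  proof (cases rule: adj_cases)
    case 2
    then have "arrow_or_line G y x" by (simp add: arrow_or_line_def)
    then show ?thesis using member_no_semi_directed_triangle[of G y x w] triangle 2 by blast
  qed
next
  case (kite c y d x)
  from kite.hyps(3) kite.prems show ?case
  proof (cases rule: adj_cases)
    case 2
    have into: "(e, x) \<in> arrows G" if "adj x e" "arrow_or_line G e y" for e
      using that(1) kite.prems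
    proof (cases rule: adj_cases)
      case 1
      have "arrow_or_line G y x" using 2 by (simp add: arrow_or_line_def)
      then have False using member_no_semi_directed_triangle[of G y x e] kite.prems 1 2 that by blast
      then show ?thesis ..
    qed
    have "(c, x) \<in> arrows G" "(d, x) \<in> arrows G" using into kite by blast+
    then have "triplex c x d"
      using kite triplex_member_iff[OF kite.prems, of c x d] by (auto simp: arrow_or_line_def)
    then show ?thesis using kite by blast
  qed
qed (auto simp: strong_line_def arrow_or_line_def)

lemma tail_irrefl: "\<not> tail x x"
  using tail_adj adj_verts by blast

lemma tail_then_free:
  assumes "tail x y" "free y z"
  shows "x \<noteq> z" "adj x z" "\<not> tail z x"
proof -
  show "x \<noteq> z" using assms by (auto simp: free_def)
  show adj: "adj x z"
  proof (rule ccontr)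
    assume nadj: "\<not> adj x z"
    show False
    proof (cases "triplex x y z")
      case True
      then show ?thesis using triplex_sym tail.triplex assms(2) unfolding free_def by blast
    next
      case False
      then have "tail y z"
        using tail.no_triplex[OF assms(1)] assms(2) \<open>x \<noteq> z\<close> nadj by (auto simp: free_def)
      then show ?thesis using assms(2) by (simp add: free_def)
    qed
  qed
  show "\<not> tail z x"
  proof
    assume "tail z x"
    then have "tail z y" using tail.triangle assms adj_sym unfolding free_def by blast
    then show False using assms(2) by (simp add: free_def)
  qed
qed

text \<open>
  If \<open>x\<close> and \<open>w\<close> form no triplex at \<open>z\<close>, then \<open>z\<close>, \<open>y\<close>, \<open>x\<close>, \<open>w\<close> form a kite that gives the free edge
  \<open>yz\<close> a tail at \<open>z\<close>.
\<close>

lemma collider_tail_propagates: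
  assumes "tail x y" "tail w y" "x \<noteq> w" "\<not> adj x w" "free y z"
  shows "tail x z"
proof (cases "triplex x z w")
  case True
  then show ?thesis by (rule tail.triplex)
next
  case False
  have "adj z x" "adj z w" using tail_then_free assms adj_sym by blast+
  then have "tail z y"
    using tail.kite[of x y w z] assms False adj_sym by (auto simp: free_def)
  then show ?thesis using assms(5) by (simp add: free_def)
qed

text \<open>
  Without adjacency of \<open>x\<close> and \<open>z\<close>, the edge \<open>yz\<close> would receive a tail, by a triplex at \<open>y\<close> or for want
  of one (\<open>tail_then_free\<close>). For the tail itself, induct on the derivation of \<open>tail x y\<close>. In most cases
  the premises of the last rule carry over from \<open>y\<close> to \<open>z\<close>, or two tails collide at \<open>y\<close>. In the cases of
  \<open>no_triplex\<close> and \<open>strong_in\<close>, the edge \<open>xz\<close> would otherwise be free; propagating a tail along it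
  then yields a tail on \<open>yz\<close>.
\<close>

lemma tail_propagates: "tail x y \<Longrightarrow> free y z \<Longrightarrow> tail x z"
proof (induction arbitrary: z rule: tail.induct)
  case (triplex x y w)
  then show ?case
    using collider_tail_propagates tail.triplex triplex_sym triplex_adj by blast
next
  case (no_triplex w x y)
  have tail_xy: "tail x y" using no_triplex.hyps by (rule tail.no_triplex)
  show ?case
  proof (rule ccontr)
    assume "\<not> tail x z"
    then have "free x z" using tail_then_free[OF tail_xy no_triplex.prems] by (simp add: free_def)
    then have wz: "tail w z" by (rule no_triplex.IH)
    have "adj z y" using no_triplex.prems adj_sym by (simp add: free_def)
    then have "tail y z \<or> tail z y"
      using tail.no_triplex[OF wz] no_triplex.hyps triplex_sym tail.triplex by blast
    then show False using no_triplex.prems by (simp add: free_def)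
  qed
next
  case (triangle x w y)
  have "tail x y" using triangle.hyps by (rule tail.triangle)
  then show ?case
    using triangle.IH(2)[OF triangle.prems] tail.triangle[OF triangle.hyps(1)]
      tail_then_free triangle.prems by blast
next
  case (kite c y d x)
  have "tail x y" using kite.hyps by (rule tail.kite)
  then have "adj x z" using tail_then_free kite.prems by blast
  then show ?case using tail.kite[of c z d x] kite by blast
next
  case (strong_out x y w)
  have "tail x y" "tail w y"
    using tail.strong_out[of x y w] tail.strong_out[of w y x] strong_out.hyps strong_line_sym adj_sym
    by blast+
  then show ?case using collider_tail_propagates strong_out by blast
next
  case (strong_in x y w)
  have xy: "tail x y" using strong_in.hyps by (rule tail.strong_in)
  have into: "tail y x" "tail w x"
    using tail.strong_out[of y x w] tail.strong_out[of w x y] strong_in.hyps strong_line_sym adj_sym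
    by blast+
  show ?case
  proof (rule ccontr)
    assume "\<not> tail x z"
    then have "free x z" using tail_then_free[OF xy strong_in.prems] by (simp add: free_def)
    then have "tail y z" using collider_tail_propagates[OF into] strong_in.hyps by blast
    then show False using strong_in.prems by (simp add: free_def)
  qed
qed

text \<open>
  In every member a closed walk of tails consists of lines only, so all its edges are strong lines. If
  the neighbours of \<open>v\<close> on the walk are nonadjacent, the rules for strong lines apply at \<open>v\<close>. If they are
  adjacent, the chord either shortens the walk or lets a tail propagate to the edge \<open>vu\<close>.
\<close>

lemma closed_tail_walk:
  assumes "tail\<^sup>*\<^sup>* v u" "tail u v"
  shows "tail v u"
  using assms
proof (induction rule: converse_rtranclp_induct)
  case base
  then show ?case .
next
  case (step v y)
  have strong: "strong_line \<G> u v \<and> strong_line \<G> v y"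
    unfolding strong_line_def
  proof (intro conjI ballI)
    fix G assume G: "G \<in> \<G>"
    let ?Q = "{(u, v). arrow_or_line G u v}"
    have walk: "(p, q) \<in> ?Q\<^sup>*" if "tail\<^sup>*\<^sup>* p q" for p q
      using that by (induction rule: rtranclp_induct)
        (auto intro: rtrancl.rtrancl_into_rtrancl tail_sound[OF _ G])
    have "tail\<^sup>*\<^sup>* v u" "tail\<^sup>*\<^sup>* y v" using step by auto
    then have "(u, v) \<notin> arrows G" "(v, y) \<notin> arrows G"
      using chain_graph_no_semi_directed_closed_walk[OF member(1)[OF G]] walk by blast+
    then show "{u, v} \<in> lines G" "{v, y} \<in> lines G"
      using tail_sound[OF _ G] step by (auto simp: arrow_or_line_def)
  qed
  show ?case
  proof (cases "u = y \<or> \<not> adj u y")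
    case True
    then show ?thesis
      using step.hyps(1) tail.strong_in[of v u y] strong strong_line_sym by blast
  next
    case False
    have "adj v u" using step.prems tail_adj adj_sym by blast
    have "tail v u" if "tail y u" using tail.triangle[OF step.hyps(1) that \<open>adj v u\<close>] .
    moreover have "tail v u" if "free y u" using tail_propagates[OF step.hyps(1) that] .
    ultimately show ?thesis using step.IH False adj_sym by (auto simp: free_def)
  qed
qed


section \<open>Orienting the free edges\<close>

lemma free_sym: "free x y \<Longrightarrow> free y x"
  by (auto simp: free_def adj_sym)

lemma free_induced:
  assumes "free x y" "free y z" "x \<noteq> z" "\<not> free x z"
  shows "\<not> adj x z"
proof
  assume "adj x z"
  then have "tail x z \<or> tail z x" using assms(4) by (auto simp: free_def)
  then show False
    using tail_propagates[of x z y] tail_propagates[of z x y] assms free_sym by (auto simp: free_def)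
qed

text \<open>
  In a member, an arrow on a closed walk of chordless steps would be continued at every step, as
  free edges are part of no triplex; this gives a directed closed walk. Reversing the walk excludes
  arrows in the other direction. So all its edges are lines in every member, and the rules for strong
  lines apply to them.
\<close>

lemma free_chordal: "acyclic (chordless_step free)"
proof -
  have step_arrow: "(v, w) \<in> arrows G"
    if "((u, v), (v, w)) \<in> chordless_step free" "(u, v) \<in> arrows G" "G \<in> \<G>" for u v w G
  proof -
    have uvw: "free u v" "free v w" "u \<noteq> w" "\<not> adj u w"
      using that(1) free_induced by (auto simp: chordless_step_def)
    then have "\<not> triplex u v w" using tail.triplex by (auto simp: free_def)
    then show ?thesis using no_triplex_arrow[OF that(3)] uvw that(2) by (auto simp: free_def)
  qed
  have no_arrow: "e \<notin> arrows G" if cyc: "(e, e) \<in> (chordless_step free)\<^sup>+" and G: "G \<in> \<G>" for e G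
  proof
    assume e: "e \<in> arrows G"
    let ?Q = "{(u, v). arrow_or_line G u v}"
    have walk: "e' \<in> arrows G \<and> (snd e, snd e') \<in> ?Q\<^sup>*" if "(e, e') \<in> (chordless_step free)\<^sup>*" for e'
      using that
    proof (induction rule: rtrancl_induct)
      case (step e' e'')
      obtain u v w where eq: "e' = (u, v)" "e'' = (v, w)"
        using step.hyps(2) by (auto simp: chordless_step_def)
      then have "(v, w) \<in> arrows G" using step_arrow[OF _ _ G] step by blast
      then show ?case
        using step.IH eq by (auto simp: arrow_or_line_def intro: rtrancl.rtrancl_into_rtrancl)
    qed (simp add: e)
    obtain e' where e': "(e, e') \<in> (chordless_step free)\<^sup>*" "(e', e) \<in> chordless_step free"
      using tranclD2[OF cyc] by blast
    then have "snd e' = fst e" by (auto simp: chordless_step_def)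
    then have "(snd e, fst e) \<in> ?Q\<^sup>*" using walk[OF e'(1)] by simp
    then show False
      using chain_graph_no_semi_directed_closed_walk[OF member(1)[OF G], of "fst e" "snd e"] e by simp
  qed
  have swap_step: "(prod.swap e', prod.swap e) \<in> chordless_step free"
    if "(e, e') \<in> chordless_step free" for e e'
  proof -
    obtain u v w where "e = (u, v)" "e' = (v, w)" "free u v" "free v w" "u \<noteq> w" "\<not> free u w"
      using \<open>(e, e') \<in> chordless_step free\<close> by (auto simp: chordless_step_def)
    moreover have "free w v" "free v u" "\<not> free w u" using calculation free_sym by blast+
    ultimately show ?thesis by (simp add: chordless_step_def)
  qed
  have swap: "(prod.swap e', prod.swap e) \<in> (chordless_step free)\<^sup>+"
    if "(e, e') \<in> (chordless_step free)\<^sup>+" for e e'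
    using that
  proof (induction rule: trancl_induct)
    case (base e')
    then show ?case using swap_step by blast
  next
    case (step e' e'')
    have "(prod.swap e'', prod.swap e') \<in> chordless_step free"
      using step.hyps(2) by (rule swap_step)
    then show ?case using step.IH by (rule trancl_into_trancl2)
  qed
  have strong: "strong_line \<G> u v"
    if "((u, v), (u, v)) \<in> (chordless_step free)\<^sup>+" "adj u v" for u v
    unfolding strong_line_def
  proof
    fix G assume G: "G \<in> \<G>"
    show "{u, v} \<in> lines G"
      using no_arrow[OF that(1) G] no_arrow[OF swap[OF that(1)] G] that(2) adj_iff[OF G]
      by (simp add: doubleton_in_skeleton)
  qed
  show ?thesis
    unfolding acyclic_def
  proof (intro allI notI)
    fix e assume cyc: "(e, e) \<in> (chordless_step free)\<^sup>+"
    then obtain e' where e': "(e, e') \<in> chordless_step free" "(e', e) \<in> (chordless_step free)\<^sup>*"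
      by (blast dest: tranclD)
    then obtain u v w where eq: "e = (u, v)" "e' = (v, w)"
      and uvw: "free u v" "free v w" "u \<noteq> w" "\<not> free u w"
      by (auto simp: chordless_step_def)
    have "(e', e') \<in> (chordless_step free)\<^sup>+" using e' by (rule rtrancl_into_trancl1[rotated])
    then have "strong_line \<G> u v" "strong_line \<G> v w"
      using strong cyc eq uvw by (auto simp: free_def)
    then have "tail u v" using tail.strong_out uvw free_induced by blast
    then show False using uvw by (simp add: free_def)
  qed
qed

definition orient :: "('a \<Rightarrow> nat) \<Rightarrow> 'a mixed_graph" where
  "orient f = \<lparr>verts = V,
     arrows = {(x, y). tail x y \<and> \<not> tail y x \<or> free x y \<and> f x < f y},
     lines = {{x, y} | x y. tail x y \<and> tail y x}\<rparr>"

lemma line_orient: "{x, y} \<in> lines (orient f) \<longleftrightarrow> tail x y \<and> tail y x"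
  by (auto simp: orient_def doubleton_eq_iff)

lemma arrow_orient:
  "(x, y) \<in> arrows (orient f) \<longleftrightarrow> tail x y \<and> \<not> tail y x \<or> free x y \<and> f x < f y"
  by (simp add: orient_def)

lemma arrow_or_line_orient:
  "arrow_or_line (orient f) x y \<longleftrightarrow> tail x y \<or> free x y \<and> f x < f y"
  by (auto simp: arrow_or_line_def arrow_orient line_orient)

lemma mixed_graph_orient: "mixed_graph (orient f)"
  unfolding mixed_graph_def
proof (intro conjI ballI allI impI)
  show "finite (verts (orient f))"
    using nonempty member(2,3) by (auto simp: mixed_graph_def orient_def)
  show "arrows (orient f) \<subseteq> verts (orient f) \<times> verts (orient f)"
    using tail_adj adj_verts by (auto simp: orient_def free_def)
  show "e \<subseteq> verts (orient f)" "card e = 2" if e: "e \<in> lines (orient f)" for e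
  proof -
    obtain x y where "e = {x, y}" "tail x y" using e by (auto simp: orient_def)
    then show "e \<subseteq> verts (orient f)" "card e = 2"
      using tail_adj adj_verts by (auto simp: orient_def card_2_iff)
  qed
  show "x \<noteq> y" "(y, x) \<notin> arrows (orient f)" "{x, y} \<notin> lines (orient f)"
    if "(x, y) \<in> arrows (orient f)" for x y
    using that tail_irrefl by (auto simp: arrow_orient line_orient free_def)
qed

lemma skeleton_orient:
  assumes f: "inj_on f V" and G: "G \<in> \<G>"
  shows "skeleton (orient f) = skeleton G"
proof -
  have pair: "{x, y} \<in> skeleton (orient f) \<longleftrightarrow> {x, y} \<in> skeleton G" for x y
  proof -
    have "f x < f y \<or> f y < f x" if "free x y"
    proof -
      have "x \<in> V" "y \<in> V" "x \<noteq> y" using that adj_verts by (auto simp: free_def)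
      then have "f x \<noteq> f y" using f by (auto dest: inj_onD)
      then show ?thesis by linarith
    qed
    then show ?thesis
      using adj_iff[OF G, symmetric] free_sym tail_adj adj_sym
      unfolding doubleton_in_skeleton line_orient arrow_orient by (auto simp: free_def)
  qed
  have "\<exists>x y. e = {x, y}" if "e \<in> skeleton H" "mixed_graph H" for e and H :: "'a mixed_graph"
  proof (cases "e \<in> lines H")
    case True
    then have "card e = 2" using that(2) by (simp add: mixed_graph_def)
    then show ?thesis by (auto simp: card_2_iff)
  next
    case False
    then show ?thesis using that(1) unfolding skeleton_def by blast
  qed
  then show ?thesis using pair mixed_graph_orient member(2)[OF G] by blast
qed

lemma triplex_orient:
  assumes f: "perfect_ordering free V f" and G: "G \<in> \<G>"
  shows "({x, z}, y) \<in> triplexes (orient f) \<longleftrightarrow> triplex x y z"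
proof -
  have inj: "inj_on f V" using f by (simp add: perfect_ordering_def)
  have iff: "({x, z}, y) \<in> triplexes (orient f) \<longleftrightarrow> x \<noteq> z \<and> \<not> adj x z \<and>
      arrow_or_line (orient f) x y \<and> arrow_or_line (orient f) z y \<and>
      ((x, y) \<in> arrows (orient f) \<or> (z, y) \<in> arrows (orient f))"
    by (simp add: triplex_iff[OF mixed_graph_orient] skeleton_orient[OF inj G] adj_iff[OF G])
  show ?thesis
  proof
    assume t: "triplex x y z"
    have "tail x y" "tail z y" using tail.triplex t triplex_sym by blast+
    moreover have "\<not> (tail y x \<and> tail y z)"
    proof
      assume "tail y x \<and> tail y z"
      then have "arrow_or_line G y x" "arrow_or_line G y z" using tail_sound G by blast+
      then have "(x, y) \<notin> arrows G" "(z, y) \<notin> arrows G"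
        using arrow_verts[OF member(2)[OF G]] by (auto simp: arrow_or_line_def)
      then show False using t triplex_member_iff[OF G] by blast
    qed
    ultimately show "({x, z}, y) \<in> triplexes (orient f)"
      using triplex_adj[OF t] unfolding iff arrow_or_line_orient arrow_orient by blast
  next
    assume h: "({x, z}, y) \<in> triplexes (orient f)"
    show "triplex x y z"
    proof (rule ccontr)
      assume nt: "\<not> triplex x y z"
      then have nt': "\<not> triplex z y x" using triplex_sym by blast
      have xz: "x \<noteq> z" "\<not> adj x z" "\<not> adj z x" using h iff adj_sym by blast+
      have into: "tail x y \<or> free x y \<and> f x < f y" "tail z y \<or> free z y \<and> f z < f y"
        using h unfolding iff arrow_or_line_orient by blast+
      then have adj: "adj y x" "adj y z" using tail_adj adj_sym by (auto simp: free_def)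
      have "tail x y \<Longrightarrow> tail y z" "tail z y \<Longrightarrow> tail y x"
        using tail.no_triplex[of x y z] tail.no_triplex[of z y x] adj xz nt nt' by blast+
      moreover have "free x z" if "free x y" "free z y" "f x < f y" "f z < f y"
        using f[unfolded perfect_ordering_def, THEN conjunct2, rule_format, of x y z] that xz adj adj_verts
        by blast
      ultimately have "tail x y \<and> tail y x \<and> tail z y \<and> tail y z"
        using into xz by (auto simp: free_def)
      then show False using h unfolding iff arrow_orient by (auto simp: free_def)
    qed
  qed
qed

lemma tail_then_oriented_walk:
  assumes "(\<lambda>u v. free u v \<and> f u < f v)\<^sup>*\<^sup>* q m" "tail p q"
  shows "tail p m"
  using assms by (induction rule: rtranclp_induct) (auto intro: tail_propagates)

text \<open>
  Tails propagate along the oriented walk to its end \<open>m\<close> and to the vertex \<open>m'\<close> before it. The closed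
  walk of tails through \<open>p\<close> and \<open>m\<close> gives a tail at \<open>m\<close> towards \<open>p\<close>, so the triangle on \<open>m\<close>, \<open>p\<close>, \<open>m'\<close>
  puts a tail on the last free edge of the walk.
\<close>

lemma oriented_walk_no_return:
  fixes f :: "'a \<Rightarrow> nat"
  assumes "tail p q" "(\<lambda>u v. free u v \<and> f u < f v)\<^sup>+\<^sup>+ q m" "tail\<^sup>*\<^sup>* m p"
  shows False
proof -
  let ?O = "\<lambda>u v. free u v \<and> f u < f v"
  obtain m' where m': "?O\<^sup>*\<^sup>* q m'" "free m' m" 
  proof -
    from assms(2) have "\<exists>m'. ?O\<^sup>*\<^sup>* q m' \<and> free m' m"
      by (cases rule: tranclp.cases) (blast dest: tranclp_into_rtranclp)+
    then show thesis using that by blast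
  qed
  have "tail p m'" using tail_then_oriented_walk m'(1) assms(1) .
  then have "tail p m" using m'(2) by (rule tail_propagates)
  then have "tail m p" using closed_tail_walk assms(3) by blast
  then have "tail m m'" using \<open>tail p m'\<close> tail.triangle m'(2) adj_sym unfolding free_def by blast
  then show False using m'(2) by (simp add: free_def)
qed

lemma chain_graph_orient: "chain_graph (orient f)"
proof (rule chain_graphI[OF mixed_graph_orient])
  fix x y assume xy: "(x, y) \<in> arrows (orient f)"
  let ?O = "\<lambda>u v. free u v \<and> f u < f v"
  \<comment> \<open>A tail absorbs an oriented free edge that follows it, so the remaining free edges come first.\<close>
  have split: "\<exists>m. ?O\<^sup>*\<^sup>* u m \<and> tail\<^sup>*\<^sup>* m v"
    if "(u, v) \<in> {(u, v). arrow_or_line (orient f) u v}\<^sup>*" for u v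
    using that
  proof (induction rule: rtrancl_induct)
    case base
    show ?case by blast
  next
    case (step v w)
    then obtain m where m: "?O\<^sup>*\<^sup>* u m" "tail\<^sup>*\<^sup>* m v" by blast
    show ?case
    proof (cases "tail v w")
      case True
      then have "tail\<^sup>*\<^sup>* m w" using m(2) by (rule rtranclp.rtrancl_into_rtrancl[rotated])
      then show ?thesis using m(1) by blast
    next
      case False
      then have vw: "?O v w" using step.hyps(2) by (simp add: arrow_or_line_orient)
      from m(2) show ?thesis
      proof (cases rule: rtranclp.cases)
        case rtrancl_refl
        then have "?O\<^sup>*\<^sup>* u v" using m(1) by simp
        then have "?O\<^sup>*\<^sup>* u w" using vw by (rule rtranclp.rtrancl_into_rtrancl)
        then show ?thesis by blast
      next
        case (rtrancl_into_rtrancl p)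
        then have "tail p w" using tail_propagates vw by blast
        then have "tail\<^sup>*\<^sup>* m w" using rtrancl_into_rtrancl(1) by (rule rtranclp.rtrancl_into_rtrancl[rotated])
        then show ?thesis using m(1) by blast
      qed
    qed
  qed
  show "(y, x) \<notin> {(u, v). arrow_or_line (orient f) u v}\<^sup>*"
  proof
    assume "(y, x) \<in> {(u, v). arrow_or_line (orient f) u v}\<^sup>*"
    then obtain m where m: "?O\<^sup>*\<^sup>* y m" "tail\<^sup>*\<^sup>* m x" using split by blast
    show False
    proof (cases "tail x y")
      case True
      then have "\<not> tail y x" using xy by (simp add: arrow_orient free_def)
      then have "y \<noteq> m" using closed_tail_walk m(2) True by blast
      then have "?O\<^sup>+\<^sup>+ y m" using rtranclpD[OF m(1)] by blast
      then show False using oriented_walk_no_return True m(2) by blast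
    next
      case False
      then have "?O x y" using xy by (simp add: arrow_orient)
      then have xm: "?O\<^sup>+\<^sup>+ x m" using m(1) by (rule rtranclp_into_tranclp2)
      have increasing: "f x < f m"
        using xm by (induction rule: tranclp_induct) auto
      from m(2) show False
      proof (cases rule: rtranclp.cases)
        case rtrancl_refl
        then show ?thesis using increasing by simp
      next
        case (rtrancl_into_rtrancl p)
        then have "tail\<^sup>*\<^sup>* m p" "tail p x" by auto
        then show ?thesis using oriented_walk_no_return xm by blast
      qed
    qed
  qed
qed

lemma orient_member:
  assumes f: "perfect_ordering free V f"
  shows "orient f \<in> \<G>"
proof -
  obtain G where G: "G \<in> \<G>" using nonempty by blast
  have inj: "inj_on f V" using f by (simp add: perfect_ordering_def)
  have "({x, z}, y) \<in> triplexes (orient f) \<longleftrightarrow> ({x, z}, y) \<in> triplexes G" for x y z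
    using triplex_orient[OF f G] triplex_iff[OF member(2)[OF G]] triplex_member_iff[OF G] adj_iff[OF G]
    by simp
  moreover have "\<exists>x y z. t = ({x, z}, y)" if "t \<in> triplexes H" for t and H :: "'a mixed_graph"
    using that unfolding triplexes_def by blast
  ultimately have "triplexes G = triplexes (orient f)" by blast
  then have "(G, orient f) \<in> amp_equivalence V"
    using skeleton_orient[OF inj G] chain_graph_orient member[OF G]
    by (simp add: amp_equivalence_def chain_graphs_on_def) (simp add: orient_def)
  then show ?thesis using in_quotient_imp_closed[OF equiv_amp_equivalence amp_class G] by blast
qed

lemma free_both_ways:
  assumes "free a b"
  obtains G where "G \<in> \<G>" "(a, b) \<in> arrows G"
proof -
  have "finite V" using nonempty member(2,3) by (auto simp: mixed_graph_def)
  moreover have V: "a \<in> V" "b \<in> V" "a \<noteq> b" using assms adj_verts by (auto simp: free_def)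
  ultimately obtain f where f: "perfect_ordering free V f" "\<forall>x\<in>V. x \<noteq> a \<longrightarrow> f a < f x"
    using ex_perfect_ordering[of free, OF free_sym free_chordal] by blast
  have "(a, b) \<in> arrows (orient f)" using f(2) V assms by (simp add: arrow_orient)
  then show thesis using that orient_member[OF f(1)] by blast
qed

section \<open>Well protected arrows\<close>

text \<open>
  The semantic counterpart of \<open>tail\<close>. On free edges \<open>free_both_ways\<close> excludes it, so the two can
  only differ at an end of an edge with a derived tail at the other end.
\<close>

definition blocked :: "'a \<Rightarrow> 'a \<Rightarrow> bool" where
  "blocked x y \<longleftrightarrow> (\<forall>G\<in>\<G>. arrow_or_line G x y)"

lemma tail_blocked: "tail x y \<Longrightarrow> blocked x y"
  by (simp add: blocked_def tail_sound)

lemma blocked_adj: "blocked x y \<Longrightarrow> adj x y"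
  using nonempty arrow_or_line_adj by (auto simp: blocked_def)

lemma not_blocked: "adj x y \<Longrightarrow> \<not> blocked x y \<Longrightarrow> \<exists>G\<in>\<G>. (y, x) \<in> arrows G"
  unfolding blocked_def using adj_cases by metis

lemma blocked_no_arrow: "blocked x y \<Longrightarrow> G \<in> \<G> \<Longrightarrow> (y, x) \<notin> arrows G"
  unfolding blocked_def arrow_or_line_def using arrow_verts member(2) by metis

lemma blocked_iff: "blocked x y \<longleftrightarrow> adj x y \<and> (\<forall>G\<in>\<G>. (y, x) \<notin> arrows G)"
  using blocked_adj blocked_no_arrow not_blocked by blast

lemma arrow_essential: "(x, y) \<in> arrows (essential_graph \<G>) \<longleftrightarrow> blocked x y \<and> \<not> blocked y x"
proof -
  have "adj x y" if "(x, y) \<in> arrows G" "G \<in> \<G>" for G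
    using that by (auto simp: adj_iff doubleton_in_skeleton)
  then show ?thesis unfolding essential_graph_def blocked_iff using adj_sym by auto
qed

lemma strong_iff: "strong_line \<G> x y \<longleftrightarrow> blocked x y \<and> blocked y x"
proof
  assume "strong_line \<G> x y"
  then show "blocked x y \<and> blocked y x"
    by (auto simp: strong_line_def blocked_def arrow_or_line_def insert_commute)
next
  assume "blocked x y \<and> blocked y x"
  then show "strong_line \<G> x y"
    using blocked_no_arrow unfolding strong_line_def blocked_def arrow_or_line_def by blast
qed

lemma weak_iff: "weak_line \<G> x y \<longleftrightarrow> adj x y \<and> \<not> blocked x y \<and> \<not> blocked y x"
proof -
  have "adj x y" if "(x, y) \<in> arrows G" "G \<in> \<G>" for G
    using that by (auto simp: adj_iff doubleton_in_skeleton)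
  then show ?thesis unfolding weak_line_def blocked_iff using adj_sym by blast
qed

lemma line_essential:
  "{x, y} \<in> lines (essential_graph \<G>) \<longleftrightarrow> adj x y \<and> (blocked x y \<longleftrightarrow> blocked y x)"
proof -
  have "{x, y} \<in> lines (essential_graph \<G>) \<longleftrightarrow> strong_line \<G> x y \<or> weak_line \<G> x y"
    unfolding essential_graph_def
    by (auto simp: doubleton_eq_iff strong_line_sym weak_line_def)
  then show ?thesis using strong_iff weak_iff blocked_adj by blast
qed

lemma mixed_graph_essential: "mixed_graph (essential_graph \<G>)"
  unfolding mixed_graph_def
proof (intro conjI ballI allI impI)
  have V: "verts (essential_graph \<G>) = V" by (rule verts_essential_graph[OF amp_class])
  show "finite (verts (essential_graph \<G>))"
    unfolding V using nonempty member(2,3) by (auto simp: mixed_graph_def)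
  show "arrows (essential_graph \<G>) \<subseteq> verts (essential_graph \<G>) \<times> verts (essential_graph \<G>)"
    unfolding V using blocked_adj adj_verts by (auto simp: arrow_essential; blast)
  show "e \<subseteq> verts (essential_graph \<G>)" "card e = 2" if e: "e \<in> lines (essential_graph \<G>)" for e
  proof -
    obtain x y where xy: "e = {x, y}" using e by (auto simp: essential_graph_def)
    then have "adj x y" using e line_essential by simp
    then show "e \<subseteq> verts (essential_graph \<G>)" "card e = 2"
      unfolding V xy using adj_verts by (auto simp: card_2_iff)
  qed
  show "x \<noteq> y" "(y, x) \<notin> arrows (essential_graph \<G>)" "{x, y} \<notin> lines (essential_graph \<G>)"
    if "(x, y) \<in> arrows (essential_graph \<G>)" for x y
    using that arrow_essential line_essential by auto
qed

lemma induced_essential_iff: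
  assumes "S \<subseteq> V" "A \<subseteq> S \<times> S" "L \<subseteq> {{x, y} | x y. x \<in> S \<and> y \<in> S}"
  shows "induced (essential_graph \<G>) S = \<lparr>verts = S, arrows = A, lines = L\<rparr> \<longleftrightarrow>
    (\<forall>x\<in>S. \<forall>y\<in>S. (blocked x y \<and> \<not> blocked y x \<longleftrightarrow> (x, y) \<in> A) \<and>
      (adj x y \<and> (blocked x y \<longleftrightarrow> blocked y x) \<longleftrightarrow> {x, y} \<in> L))"
  using induced_eq_iff[OF mixed_graph_essential _ assms(2,3)] assms(1)
  by (simp add: verts_essential_graph[OF amp_class] arrow_essential line_essential)


lemmas induced_essential_eq = iffD2[OF induced_essential_iff]

lemma nonadj_not_blocked: "\<not> adj x y \<Longrightarrow> \<not> blocked x y"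
  using blocked_adj by blast

lemma not_adj_self: "\<not> adj x x"
  using adj_verts by blast

text \<open>
  Depending on whether \<open>ca\<close> is blocked at \<open>a\<close> too, it is a strong line or an arrow into \<open>a\<close>.
\<close>

lemma protected_by_tail_side:
  assumes ab: "blocked a b" "\<not> blocked b a" and c: "blocked c a" "c \<noteq> b" "\<not> adj c b"
  shows "well_protected \<G> a b"
proof -
  have adj: "adj a b" "adj b a" "adj a c" "adj c a" "\<not> adj b c" "\<not> adj c b"
    using ab c blocked_adj adj_sym by blast+
  then have V: "{a, b, c} \<subseteq> V" and ne: "a \<noteq> b" "a \<noteq> c" "b \<noteq> c" "b \<noteq> a" "c \<noteq> a" "c \<noteq> b"
    using adj_verts c by blast+
  have off: "\<not> blocked b c" "\<not> blocked c b" "\<And>x. \<not> blocked x x"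
    using adj nonadj_not_blocked not_adj_self by blast+
  show ?thesis
  proof (cases "blocked a c")
    case True
    then have "induced (essential_graph \<G>) {a, b, c} = \<lparr>verts = {a, b, c}, arrows = {(a, b)}, lines = {{a, c}}\<rparr>"
      by (intro induced_essential_eq V) (auto simp: ab c adj ne off not_adj_self doubleton_eq_iff)
    moreover have "distinct [a, b, c] \<and> strong_line \<G> a c" using True ab c ne by (simp add: strong_iff)
    ultimately show ?thesis unfolding well_protected_def Let_def by blast
  next
    case False
    then have "induced (essential_graph \<G>) {a, b, c} = \<lparr>verts = {a, b, c}, arrows = {(c, a), (a, b)}, lines = {}\<rparr>"
      by (intro induced_essential_eq V) (auto simp: ab c adj ne off not_adj_self doubleton_eq_iff)
    moreover have "distinct [a, b, c]" using ne by simp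
    ultimately show ?thesis unfolding well_protected_def Let_def by blast
  qed
qed

lemma protected_by_head_side:
  assumes ab: "blocked a b" "\<not> blocked b a" and c: "blocked c b" "a \<noteq> c" "\<not> adj a c"
  shows "well_protected \<G> a b"
proof -
  have adj: "adj a b" "adj b a" "adj b c" "adj c b" "\<not> adj a c" "\<not> adj c a"
    using ab c blocked_adj adj_sym by blast+
  then have V: "{a, b, c} \<subseteq> V" and ne: "a \<noteq> b" "a \<noteq> c" "b \<noteq> c" "b \<noteq> a" "c \<noteq> a" "c \<noteq> b"
    using adj_verts c by blast+
  have off: "\<not> blocked a c" "\<not> blocked c a" "\<And>x. \<not> blocked x x"
    using adj nonadj_not_blocked not_adj_self by blast+
  show ?thesis
  proof (cases "blocked b c")
    case True
    then have "induced (essential_graph \<G>) {a, b, c} = \<lparr>verts = {a, b, c}, arrows = {(a, b)}, lines = {{b, c}}\<rparr>"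
      by (intro induced_essential_eq V) (auto simp: ab c adj ne off not_adj_self doubleton_eq_iff)
    moreover have "distinct [a, b, c] \<and> strong_line \<G> b c" using True ab c ne by (simp add: strong_iff)
    ultimately show ?thesis unfolding well_protected_def Let_def by blast
  next
    case False
    then have "induced (essential_graph \<G>) {a, b, c} = \<lparr>verts = {a, b, c}, arrows = {(a, b), (c, b)}, lines = {}\<rparr>"
      by (intro induced_essential_eq V) (auto simp: ab c adj ne off not_adj_self doubleton_eq_iff)
    moreover have "distinct [a, b, c]" using ne by simp
    ultimately show ?thesis unfolding well_protected_def Let_def by blast
  qed
qed

text \<open>
  The edges \<open>ac\<close> and \<open>cb\<close> cannot both be strong lines; each of the other combinations is protecting.
\<close>

lemma protected_by_triangle:
  assumes ab: "blocked a b" "\<not> blocked b a" and c: "blocked a c" "blocked c b"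
  shows "well_protected \<G> a b"
proof -
  have adj: "adj a b" "adj b a" "adj b c" "adj c b" "adj a c" "adj c a"
    using ab c blocked_adj adj_sym by blast+
  then have V: "{a, b, c} \<subseteq> V" and ne: "a \<noteq> b" "a \<noteq> c" "b \<noteq> c" "b \<noteq> a" "c \<noteq> a" "c \<noteq> b"
    using adj_verts c by blast+
  have off: "\<And>x. \<not> blocked x x"
    using adj nonadj_not_blocked not_adj_self by blast+
  \<comment> \<open>Otherwise the arrow from \<open>a\<close> to \<open>b\<close> in some member could be closed by a walk through \<open>c\<close>.\<close>
  have not_both: "\<not> (blocked c a \<and> blocked b c)"
  proof
    assume both: "blocked c a \<and> blocked b c"
    obtain G where "G \<in> \<G>" "(a, b) \<in> arrows G" using not_blocked[OF adj(2) ab(2)] by blast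
    then show False
      using member_no_semi_directed_triangle[of G a b c] both ab(1) by (auto simp: blocked_def)
  qed
  then consider "blocked c a" "\<not> blocked b c" | "\<not> blocked c a" "blocked b c" | "\<not> blocked c a" "\<not> blocked b c"
    by blast
  then show ?thesis
  proof cases
    case 1
    then have "induced (essential_graph \<G>) {a, b, c} =
        \<lparr>verts = {a, b, c}, arrows = {(a, b), (c, b)}, lines = {{a, c}}\<rparr>"
      by (intro induced_essential_eq V) (auto simp: ab c adj ne off not_adj_self doubleton_eq_iff)
    moreover have "distinct [a, b, c] \<and> strong_line \<G> a c" using 1 ab c ne by (simp add: strong_iff)
    ultimately show ?thesis unfolding well_protected_def Let_def by blast
  next
    case 2
    then have "induced (essential_graph \<G>) {a, b, c} =
        \<lparr>verts = {a, b, c}, arrows = {(a, b), (a, c)}, lines = {{b, c}}\<rparr>"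
      by (intro induced_essential_eq V) (auto simp: ab c adj ne off not_adj_self doubleton_eq_iff)
    moreover have "distinct [a, b, c] \<and> strong_line \<G> b c" using 2 ab c ne by (simp add: strong_iff)
    ultimately show ?thesis unfolding well_protected_def Let_def by blast
  next
    case 3
    then have "induced (essential_graph \<G>) {a, b, c} =
        \<lparr>verts = {a, b, c}, arrows = {(a, b), (a, c), (c, b)}, lines = {}\<rparr>"
      by (intro induced_essential_eq V) (auto simp: ab c adj ne off not_adj_self doubleton_eq_iff)
    moreover have "distinct [a, b, c]" using ne by simp
    ultimately show ?thesis unfolding well_protected_def Let_def by blast
  qed
qed

text \<open>
  If both \<open>ac\<close> and \<open>ad\<close> are weak lines, this is the protecting kite. If one of them is blocked at \<open>a\<close>, there is a
  protecting triangle; if one is blocked at its other end, the missing triplex at \<open>a\<close> blocks the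
  other one at \<open>a\<close>.
\<close>

lemma protected_by_kite:
  assumes ab: "blocked a b" "\<not> blocked b a" and into: "blocked c b" "blocked d b"
    and ac: "adj a c" and ad: "adj a d" and cd: "c \<noteq> d" "\<not> adj c d" and nt: "\<not> triplex c a d"
  shows "well_protected \<G> a b"
proof (cases "blocked a c \<or> blocked a d")
  case True
  then show ?thesis using protected_by_triangle ab into by blast
next
  case no_out: False
  have onward: "blocked a y"
    if "blocked x a" "adj a y" "x \<noteq> y" "\<not> adj x y" "\<not> triplex x a y" for x y
    unfolding blocked_def
  proof
    fix G assume G: "G \<in> \<G>"
    from that(2) G show "arrow_or_line G a y"
    proof (cases rule: adj_cases)
      case 2
      then have "triplex x a y"
        using that G triplex_member_iff[OF G] by (auto simp: blocked_def arrow_or_line_def)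
      then show ?thesis using that(5) by blast
    qed
  qed
  have no_in: "\<not> blocked c a" "\<not> blocked d a"
    using onward[of c d] onward[of d c] no_out ac ad cd nt adj_sym triplex_sym by blast+
  \<comment> \<open>Some member has the arrow from \<open>e\<close> to \<open>a\<close>, which a block at \<open>b\<close> on \<open>be\<close> would close to a semi-directed cycle.\<close>
  have arrow: "\<not> blocked b e" if e: "adj a e" "\<not> blocked a e" for e
  proof
    assume be: "blocked b e"
    obtain G where "G \<in> \<G>" "(e, a) \<in> arrows G" using not_blocked[OF e] by blast
    then show False
      using member_no_semi_directed_triangle[of G e a b] be ab(1)
      by (auto simp: blocked_def arrow_or_line_def)
  qed
  have be: "\<not> blocked b c" "\<not> blocked b d" using arrow ac ad no_out by blast+
  have adj: "adj a b" "adj b a" "adj b c" "adj c b" "adj a c" "adj c a" "adj a d" "adj d a"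
      "adj d b" "adj b d" "\<not> adj c d" "\<not> adj d c"
    using ab into ac ad cd blocked_adj adj_sym by blast+
  then have V: "{a, b, c, d} \<subseteq> V" and ne: "a \<noteq> b" "a \<noteq> c" "b \<noteq> c" "b \<noteq> a" "c \<noteq> a" "c \<noteq> b"
      "a \<noteq> d" "d \<noteq> a" "b \<noteq> d" "d \<noteq> b" "d \<noteq> c"
    using adj_verts cd by blast+
  have off: "\<not> blocked c d" "\<not> blocked d c" "\<And>x. \<not> blocked x x"
    using adj nonadj_not_blocked not_adj_self by blast+
  have "induced (essential_graph \<G>) {a, b, c, d} =
      \<lparr>verts = {a, b, c, d}, arrows = {(a, b), (c, b), (d, b)}, lines = {{a, c}, {a, d}}\<rparr>"
    using no_out by (intro induced_essential_eq V)
      (auto simp: ab into be no_in adj ne cd(1) off not_adj_self doubleton_eq_iff)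
  moreover have "distinct [a, b, c, d]" using ne cd(1) by simp
  ultimately show ?thesis unfolding well_protected_def Let_def by blast
qed

text \<open>
  A free edge occurs in both directions in the class, hence is a weak line.
\<close>

lemma essential_arrow_tail:
  assumes "blocked a b" "\<not> blocked b a"
  shows "tail a b"
proof (rule ccontr)
  assume "\<not> tail a b"
  moreover have "\<not> tail b a" using tail_blocked assms(2) by blast
  ultimately have "free b a" using blocked_adj[OF assms(1)] adj_sym by (simp add: free_def)
  then obtain G where "G \<in> \<G>" "(b, a) \<in> arrows G" by (rule free_both_ways)
  then show False using blocked_no_arrow assms(1) by blast
qed

lemma essential_arrow_well_protected:
  assumes "(a, b) \<in> arrows (essential_graph \<G>)"
  shows "well_protected \<G> a b"
proof -
  have ab: "blocked a b" "\<not> blocked b a" using assms arrow_essential by blast+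
  then have "tail a b" by (rule essential_arrow_tail)
  then show ?thesis
  proof (cases rule: tail.cases)
    case (triplex w)
    then show ?thesis
      using protected_by_head_side[OF ab, of w] tail.triplex[THEN tail_blocked] triplex_sym triplex_adj
      by blast
  next
    case (no_triplex w)
    then show ?thesis using protected_by_tail_side[OF ab] tail_blocked by blast
  next
    case (triangle w)
    then show ?thesis using protected_by_triangle[OF ab] tail_blocked by blast
  next
    case (kite c d)
    then show ?thesis using protected_by_kite[OF ab] tail_blocked by blast
  next
    case (strong_out w)
    then show ?thesis using strong_iff ab(2) by blast
  next
    case (strong_in w)
    then show ?thesis using strong_iff ab(2) by blast
  qed
qed

end

theorem proposition4p3:
  fixes V :: "'a set" and \<G> :: "'a mixed_graph set" and a b :: 'a
  assumes "\<G> \<in> chain_graphs_on V // amp_equivalence V"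
    and "(a, b) \<in> arrows (essential_graph \<G>)"
  shows "well_protected \<G> a b"
  by (rule amp_class.essential_arrow_well_protected[OF amp_class.intro[OF assms(1)] assms(2)])

end
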